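(* Let $q$ be an odd prime power, $t\ge 3$, $n=2t$, and let $\psi(x)=\frac12\bigl(x^{q}+x^{q^{t-1}}-x^{q^{t+1}}+x^{q^{2t-1}}\bigr)\in\mathbb{F}_{q^n}[x]$. The map $\psi:\mathbb{F}_{q^n}\to\mathbb{F}_{q^n}$ has order $n$ (under composition of maps).
   Context: $q$-polynomials, i.e. polynomials of the form $\sum_i c_i x^{q^i}$ over $\mathbb{F}_{q^n}$, are considered as $\mathbb{F}_q$-linear maps $\mathbb{F}_{q^n}\to\mathbb{F}_{q^n}$ (reduced modulo $x^{q^n}-x$). Equivalently, $\psi=\alpha+\beta$, where $\alpha(x)=\frac12\bigl(x+x^{q^t}\bigr)^{q^{t-1}}$ and $\beta(x)=\frac12\bigl(x-x^{q^t}\bigr)^q$. *)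

theory Defs
  imports
    "HOL-Computational_Algebra.Polynomial"
    "HOL-Number_Theory.Prime_Powers"
    "HOL-Algebra.Bij"
    "HOL-Algebra.Multiplicative_Group"
begin

(* HOL-Algebra, imported here, declares monom and smult of its own; hence the qualifiers. *)
definition psi_poly :: "nat \<Rightarrow> nat \<Rightarrow> 'a::field poly" where
  "psi_poly q t = Polynomial.smult (1 / 2)
     (Polynomial.monom 1 q + Polynomial.monom 1 (q ^ (t - 1))
      - Polynomial.monom 1 (q ^ (t + 1)) + Polynomial.monom 1 (q ^ (2 * t - 1)))"

definition psi :: "nat \<Rightarrow> nat \<Rightarrow> 'a::field \<Rightarrow> 'a" where
  "psi q t = poly (psi_poly q t)"

end

theory Submission
  imports Defs "HOL-Number_Theory.Residues"
begin

text \<open>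
  Write \<open>\<phi>\<close> for the Frobenius map \<open>x \<mapsto> x\<^sup>q\<close> of the field \<open>K\<close> with \<open>q\<^sup>n = q\<^bsup>2t\<^esup>\<close> elements, and
  \<open>\<sigma> = \<phi>\<^sup>t\<close>, an additive involution. As \<open>2\<close> is invertible, \<open>K\<close> is the direct sum of the
  eigenspaces \<open>E\<close> and \<open>F\<close> of \<open>\<sigma>\<close> for the eigenvalues \<open>1\<close> and \<open>-1\<close>. The map \<open>\<psi>\<close> is additive, and
  its formula is made so that it acts on the summands by powers of \<open>\<phi>\<close>: as \<open>\<phi>\<^bsup>t-1\<^esup>\<close> on \<open>E\<close> and as
  \<open>\<phi>\<close> on \<open>F\<close> (lemmas \<open>psi_on_fixed\<close> and \<open>psi_on_anti\<close>).

  Hence \<open>\<psi>\<^sup>t\<close> is the identity on \<open>E\<close>, where \<open>\<phi>\<^sup>t = \<sigma> = 1\<close>, and equals \<open>\<sigma> = -1\<close> on \<open>F\<close>; that is,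
  \<open>\<psi>\<^sup>t = \<sigma>\<close>, and so \<open>\<psi>\<^sup>n = \<sigma>\<^sup>2 = 1\<close>. Conversely let \<open>\<psi>\<^sup>k = 1\<close>. Each of \<open>E\<close> and \<open>F\<close> is the
  zero set of a polynomial of degree \<open>q\<^sup>t\<close>, while the product of their sizes is at least
  \<open>q\<^bsup>2t\<^esup>\<close>; so both have exactly \<open>q\<^sup>t\<close> elements. On \<open>E\<close> the map \<open>\<psi>\<close> is the inverse of \<open>\<phi>\<close>, so
  \<open>\<phi>\<^sup>k\<close> fixes \<open>E\<close> pointwise; for \<open>d = k mod t > 0\<close> the polynomial \<open>X\<^bsup>q^d\<^esup> - X\<close> would then
  have \<open>q\<^sup>t\<close> zeros, which exceeds its degree. Thus \<open>t\<close> divides \<open>k\<close>, and \<open>k / t\<close> is even since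
  \<open>\<sigma> \<noteq> 1\<close>, \<open>F\<close> being nonzero.
\<close>

section \<open>Finite fields\<close>

text \<open>
  Multiplication by a nonzero \<open>x\<close> permutes the nonzero elements and so preserves their product.
\<close>

lemma power_CARD_eq_self:
  fixes x :: "'a :: {field, finite}"
  shows "x ^ card (UNIV :: 'a set) = x"
proof (cases "x = 0")
  case False
  let ?N = "- {0 :: 'a}"
  have "(\<lambda>y. x * y) ` ?N = ?N"
    using False by (intro card_subset_eq) (auto intro!: card_image inj_onI)
  moreover have "inj_on (\<lambda>y. x * y) ?N"
    using False by (auto intro: inj_onI)
  ultimately have "\<Prod>?N = (\<Prod>y\<in>?N. x * y)"
    by (metis (no_types, lifting) prod.reindex_cong)
  also have "\<dots> = x ^ card ?N * \<Prod>?N"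
    by (simp add: prod.distrib)
  finally have "x ^ card ?N = 1"
    by simp
  moreover have "card (UNIV :: 'a set) = Suc (card ?N)"
    by (metis card_insert_disjoint finite ComplD Compl_partition insertI1 insert_is_Un)
  ultimately show ?thesis
    by simp
qed (simp add: finite_UNIV_card_ge_0)

lemma card_power_eq_scaled_le:
  fixes c :: "'a :: field"
  assumes "m > 1"
  shows "card {x. x ^ m = c * x} \<le> m"
proof -
  let ?p = "Polynomial.monom 1 m - [:0, c:]"
  have "Polynomial.coeff ?p m = 1"
    using assms by (auto simp: coeff_pCons split: nat.split)
  hence nz: "?p \<noteq> 0"
    by (metis Polynomial.coeff_0 zero_neq_one)
  have "Polynomial.degree ?p \<le> m"
    using assms by (intro degree_diff_le) (auto simp: degree_monom_eq)
  moreover have "{x. x ^ m = c * x} = {x. poly ?p x = 0}"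
    by (auto simp: poly_monom algebra_simps)
  ultimately show ?thesis
    using card_poly_roots_bound[OF nz] by simp
qed

section \<open>The involution and its eigenspaces\<close>

locale even_degree_extension =
  fixes q t :: nat and field_type :: "'a :: {field, finite} itself"
  assumes q_primepow: "primepow q" and q_odd: "odd q" and t_pos: "t > 0"
    and card_field: "card (UNIV :: 'a set) = q ^ (2 * t)"
begin

definition fixed :: "'a set" where "fixed = {x. x ^ (q ^ t) = x}"

definition anti :: "'a set" where "anti = {x. x ^ (q ^ t) = - x}"

lemma q_gt_1: "q > 1"
  using primepow_gt_Suc_0[OF q_primepow] by simp

lemma q_power_of_char: obtains m where "prime CHAR('a)" "q = CHAR('a) ^ m"
proof -
  obtain p m where p: "prime p" "q = p ^ m"
    using q_primepow by (auto simp: primepow_def)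
  have "prime CHAR('a)"
    by (intro prime_CHAR_semidom finite_imp_CHAR_pos) simp
  moreover have "CHAR('a) dvd p ^ (m * (2 * t))"
    using CHAR_dvd_CARD[where 'a = 'a] card_field p by (simp add: power_mult)
  ultimately have "CHAR('a) = p"
    using p(1) by (metis prime_dvd_power primes_dvd_imp_eq)
  thus ?thesis
    using p \<open>prime CHAR('a)\<close> that by simp
qed

lemma frobenius_add: "(x + y :: 'a) ^ (q ^ k) = x ^ (q ^ k) + y ^ (q ^ k)"
proof -
  obtain m where "prime CHAR('a)" "q = CHAR('a) ^ m"
    by (rule q_power_of_char)
  thus ?thesis
    by (intro freshmans_dream'[where n = "m * k"]) (simp_all add: power_mult)
qed

lemma frobenius_minus: "(- x :: 'a) ^ (q ^ k) = - (x ^ (q ^ k))"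
  using q_odd by simp

lemma frobenius_diff: "(x - y :: 'a) ^ (q ^ k) = x ^ (q ^ k) - y ^ (q ^ k)"
  using frobenius_add[of x "- y" k] by (simp add: frobenius_minus)

lemma frobenius_frobenius: "((x :: 'a) ^ (q ^ j)) ^ (q ^ k) = x ^ (q ^ (j + k))"
  by (simp add: power_add power_mult)

lemma frobenius_commute: "((x :: 'a) ^ (q ^ j)) ^ (q ^ k) = (x ^ (q ^ k)) ^ (q ^ j)"
  by (simp only: frobenius_frobenius add.commute)

lemma frobenius_2t: "(x :: 'a) ^ (q ^ (2 * t)) = x"
  using power_CARD_eq_self[of x] card_field by simp

lemma two_neq_zero: "(2 :: 'a) \<noteq> 0"
proof
  assume "(2 :: 'a) = 0"
  hence "CHAR('a) dvd 2"
    by (metis of_nat_eq_0_iff_char_dvd of_nat_numeral)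
  obtain m where m: "prime CHAR('a)" "q = CHAR('a) ^ m"
    by (rule q_power_of_char)
  hence "CHAR('a) = 2"
    using \<open>CHAR('a) dvd 2\<close> by (simp add: primes_dvd_imp_eq two_is_prime_nat)
  thus False
    using m q_odd q_gt_1 by (cases m) auto
qed

lemma frobenius_half: "((x :: 'a) / 2) ^ (q ^ k) = x ^ (q ^ k) / 2"
proof -
  have "x ^ (q ^ k) = (x / 2 + x / 2) ^ (q ^ k)"
    using two_neq_zero by (simp add: field_simps)
  also have "\<dots> = 2 * (x / 2) ^ (q ^ k)"
    by (simp only: frobenius_add mult_2)
  finally show ?thesis
    using two_neq_zero by simp
qed

lemma fixed_anti_decomposition:
  obtains u v :: 'a where "u \<in> fixed" "v \<in> anti" "x = u + v"
proof
  have involution: "(x ^ (q ^ t)) ^ (q ^ t) = x"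
    using frobenius_2t[of x] by (simp only: frobenius_frobenius mult_2)
  show "(x + x ^ (q ^ t)) / 2 \<in> fixed"
    unfolding fixed_def by (simp add: frobenius_half frobenius_add involution add.commute)
  show "(x - x ^ (q ^ t)) / 2 \<in> anti"
    unfolding anti_def
    by (simp only: mem_Collect_eq frobenius_half frobenius_diff involution
        minus_divide_left minus_diff_eq)
  show "x = (x + x ^ (q ^ t)) / 2 + (x - x ^ (q ^ t)) / 2"
    using two_neq_zero by (simp flip: add_divide_distrib)
qed

text \<open>
  Both eigenspaces are zero sets of polynomials of degree \<open>q\<^sup>t\<close>, and their sums exhaust a field of
  size \<open>q\<^sup>t * q\<^sup>t\<close>, which leaves no slack in either bound.
\<close>

lemma card_eigenspaces: "card fixed = q ^ t" "card anti = q ^ t"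
proof -
  have "q ^ t > 1"
    using q_gt_1 t_pos by (rule one_less_power)
  hence le: "card fixed \<le> q ^ t" "card anti \<le> q ^ t"
    using card_power_eq_scaled_le[of "q ^ t" "1 :: 'a"]
      card_power_eq_scaled_le[of "q ^ t" "-1 :: 'a"]
    by (simp_all add: fixed_def anti_def)
  have "x \<in> (\<lambda>(u, v). u + v) ` (fixed \<times> anti)" for x :: 'a
    by (rule fixed_anti_decomposition[of x]) auto
  hence "(UNIV :: 'a set) \<subseteq> (\<lambda>(u, v). u + v) ` (fixed \<times> anti)"
    by blast
  hence "card (UNIV :: 'a set) \<le> card (fixed \<times> anti)"
    by (meson finite surj_card_le)
  hence ge: "q ^ t * q ^ t \<le> card fixed * card anti"
    by (simp add: card_field card_cartesian_product mult_2 power_add)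
  have "q ^ t * q ^ t \<le> card fixed * q ^ t" "q ^ t * q ^ t \<le> q ^ t * card anti"
    using ge le by (meson le_trans mult_le_mono order_refl)+
  moreover have "q ^ t > 0"
    using \<open>q ^ t > 1\<close> by linarith
  ultimately have "q ^ t \<le> card fixed" "q ^ t \<le> card anti"
    by (meson mult_right_le_imp_le mult_left_le_imp_le)+
  thus "card fixed = q ^ t" "card anti = q ^ t"
    using le by linarith+
qed

lemma frobenius_on_fixed: "u \<in> fixed \<Longrightarrow> u ^ (q ^ (t * k)) = u"
proof (induction k)
  case (Suc k)
  have "u ^ (q ^ (t * Suc k)) = (u ^ (q ^ t)) ^ (q ^ (t * k))"
    by (simp add: frobenius_frobenius)
  thus ?case
    using Suc by (simp add: fixed_def)
qed simp

lemma frobenius_in_fixed: "u \<in> fixed \<Longrightarrow> u ^ (q ^ k) \<in> fixed"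
  unfolding fixed_def mem_Collect_eq frobenius_commute[of u k t]
  by (rule arg_cong[where f = "\<lambda>x. x ^ (q ^ k)"])

lemma frobenius_in_anti: "v \<in> anti \<Longrightarrow> v ^ (q ^ k) \<in> anti"
  unfolding anti_def mem_Collect_eq frobenius_commute[of v k t]
  by (simp only: frobenius_minus)

text \<open>
  On the fixed field the Frobenius map has order at least \<open>t\<close>, since an equation of degree
  \<open>q\<^sup>d\<close> with \<open>d < t\<close> has too few solutions.
\<close>

lemma dvd_if_frobenius_trivial_on_fixed:
  assumes "\<And>u. u \<in> fixed \<Longrightarrow> u ^ (q ^ k) = u"
  shows "t dvd k"
proof (rule ccontr)
  assume "\<not> t dvd k"
  define d where "d = k mod t"
  have d: "0 < d" "d < t"
    using \<open>\<not> t dvd k\<close> t_pos by (auto simp: d_def mod_greater_zero_iff_not_dvd)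
  have "u ^ (q ^ d) = u" if "u \<in> fixed" for u
  proof -
    have "u ^ (q ^ k) = (u ^ (q ^ (t * (k div t)))) ^ (q ^ d)"
      by (simp add: frobenius_frobenius d_def)
    thus ?thesis
      using assms that by (simp add: frobenius_on_fixed)
  qed
  hence "card fixed \<le> card {u :: 'a. u ^ (q ^ d) = 1 * u}"
    by (intro card_mono) auto
  also have "\<dots> \<le> q ^ d"
    using d q_gt_1 by (intro card_power_eq_scaled_le one_less_power)
  also have "\<dots> < q ^ t"
    using d q_gt_1 by simp
  finally show False
    by (simp add: card_eigenspaces)
qed

section \<open>The action of the map on the eigenspaces\<close>

text \<open>
  The last two exponents are written as \<open>t + k\<close> so that \<open>\<sigma>\<close> can be split off: on an eigenspace
  it acts by its sign, which makes two of the four terms cancel and the other two agree.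
\<close>

lemma psi_expand:
  "psi q t (x :: 'a) =
     (x ^ (q ^ 1) + x ^ (q ^ (t - 1)) - x ^ (q ^ (t + 1)) + x ^ (q ^ (t + (t - 1)))) / 2"
proof -
  have "2 * t - 1 = t + (t - 1)"
    using t_pos by simp
  thus ?thesis
    by (simp only: psi_def psi_poly_def poly_smult poly_add poly_diff poly_monom
        mult_1 power_one_right times_divide_eq_left)
qed

lemma psi_add: "psi q t (x + y :: 'a) = psi q t x + psi q t y"
  by (simp only: psi_expand frobenius_add add_divide_distrib diff_divide_distrib) simp

lemma psi_on_fixed:
  assumes "u \<in> fixed"
  shows "psi q t u = u ^ (q ^ (t - 1))"
proof -
  have "u ^ (q ^ (t + k)) = u ^ (q ^ k)" for k
    using assms by (simp add: fixed_def flip: frobenius_frobenius)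
  thus ?thesis
    using two_neq_zero by (simp only: psi_expand) simp
qed

lemma psi_on_anti:
  assumes "v \<in> anti"
  shows "psi q t v = v ^ q"
proof -
  have "v ^ (q ^ (t + k)) = - (v ^ (q ^ k))" for k
    using assms by (simp add: anti_def frobenius_minus flip: frobenius_frobenius)
  thus ?thesis
    using two_neq_zero by (simp only: psi_expand) simp
qed

lemma funpow_psi_add: "(psi q t ^^ k) (x + y :: 'a) = (psi q t ^^ k) x + (psi q t ^^ k) y"
  by (induction k) (simp_all add: psi_add)

lemma funpow_psi_on_fixed: "u \<in> fixed \<Longrightarrow> (psi q t ^^ k) u = u ^ (q ^ ((t - 1) * k))"
proof (induction k)
  case (Suc k)
  thus ?case
    by (simp add: psi_on_fixed frobenius_in_fixed)
      (simp only: frobenius_frobenius add.commute)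
qed simp

lemma funpow_psi_on_anti: "v \<in> anti \<Longrightarrow> (psi q t ^^ k) v = v ^ (q ^ k)"
proof (induction k)
  case (Suc k)
  thus ?case
    by (simp add: psi_on_anti frobenius_in_anti) (simp only: mult.commute flip: power_mult)
qed simp

lemma funpow_psi_t: "psi q t ^^ t = (\<lambda>x :: 'a. x ^ (q ^ t))"
proof
  fix x :: 'a
  obtain u v where uv: "u \<in> fixed" "v \<in> anti" "x = u + v"
    by (rule fixed_anti_decomposition)
  have "(psi q t ^^ t) u = u ^ (q ^ t)"
    using uv(1) frobenius_on_fixed[of u "t - 1"] frobenius_on_fixed[of u 1]
    by (simp add: funpow_psi_on_fixed mult.commute)
  thus "(psi q t ^^ t) x = x ^ (q ^ t)"
    using uv by (simp add: funpow_psi_add funpow_psi_on_anti frobenius_add)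
qed

lemma funpow_psi_2t: "psi q t ^^ (2 * t) = (id :: 'a \<Rightarrow> 'a)"
proof
  fix x :: 'a
  show "(psi q t ^^ (2 * t)) x = id x"
    using frobenius_2t[of x]
    by (simp only: mult_2 funpow_add funpow_psi_t comp_apply frobenius_frobenius id_apply)
qed

lemma funpow_psi_multiple: "psi q t ^^ (2 * t * i) = (id :: 'a \<Rightarrow> 'a)"
proof -
  have "psi q t ^^ (2 * t * i) = ((psi q t :: 'a \<Rightarrow> 'a) ^^ (2 * t)) ^^ i"
    by (simp only: funpow_mult mult.commute)
  thus ?thesis
    by (simp only: funpow_psi_2t id_funpow)
qed

lemma bij_psi: "bij (psi q t :: 'a \<Rightarrow> 'a)"
proof (rule o_bij)
  have "2 * t = Suc (2 * t - 1)"
    using t_pos by simp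
  thus "psi q t \<circ> (psi q t ^^ (2 * t - 1)) = (id :: 'a \<Rightarrow> 'a)"
    "(psi q t ^^ (2 * t - 1)) \<circ> psi q t = (id :: 'a \<Rightarrow> 'a)"
    using funpow_psi_2t by (metis funpow.simps(2), metis funpow_Suc_right)
qed

text \<open>
  The map is the inverse of the Frobenius map on the fixed field, which yields \<open>t dvd k\<close>; what
  then remains is to exclude odd multiples of \<open>t\<close>, and for those any nonzero element of the
  eigenspace of \<open>-1\<close> is negated.
\<close>

lemma funpow_psi_eq_id_iff: "psi q t ^^ k = (id :: 'a \<Rightarrow> 'a) \<longleftrightarrow> 2 * t dvd k"
proof
  assume "2 * t dvd k"
  thus "psi q t ^^ k = (id :: 'a \<Rightarrow> 'a)"
    by (elim dvdE) (simp only: funpow_psi_multiple)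
next
  assume id: "psi q t ^^ k = (id :: 'a \<Rightarrow> 'a)"
  have "u ^ (q ^ k) = u" if "u \<in> fixed" for u
  proof -
    have "u ^ (q ^ ((t - 1) * k)) = u"
      using funpow_psi_on_fixed[OF that, of k] id by (metis id_apply)
    moreover have "(t - 1) * k + k = t * k"
      using t_pos by (cases t) auto
    ultimately show ?thesis
      using frobenius_on_fixed[OF that, of k] frobenius_frobenius[of u "(t - 1) * k" k] by simp
  qed
  hence "t dvd k"
    by (rule dvd_if_frobenius_trivial_on_fixed)
  then obtain j where j: "k = t * j"
    by (rule dvdE)
  have "even j"
  proof (rule ccontr)
    assume "odd j"
    then obtain i where "j = 2 * i + 1"
      by (rule oddE)
    hence "k = t + 2 * t * i"
      using j by (simp add: algebra_simps)
    hence "(psi q t ^^ t) \<circ> (psi q t ^^ (2 * t * i)) = (id :: 'a \<Rightarrow> 'a)"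
      using id by (simp only: funpow_add)
    hence "v ^ (q ^ t) = v" for v :: 'a
      by (simp only: funpow_psi_multiple funpow_psi_t comp_id) (metis id_apply)
    hence "v + v = 0" if "v \<in> anti" for v
      using that by (metis (mono_tags, lifting) add.right_inverse anti_def mem_Collect_eq)
    hence "anti \<subseteq> {0}"
      using two_neq_zero by (simp add: subset_iff flip: mult_2)
    hence "card anti \<le> card {0 :: 'a}"
      by (intro card_mono) simp_all
    thus False
      using one_less_power[OF q_gt_1 t_pos] by (simp add: card_eigenspaces)
  qed
  thus "2 * t dvd k"
    using j mult_dvd_mono[of t t 2 j] by (simp add: mult.commute)
qed

end

section \<open>The order in the group of bijections\<close>

lemma pow_BijGroup_UNIV:
  assumes "bij f"
  shows "f [^]\<^bsub>BijGroup UNIV\<^esub> (k :: nat) = f ^^ k"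
proof (induction k)
  case 0
  show ?case
    by (simp add: BijGroup_def id_def)
next
  case (Suc k)
  have "f ^^ k \<in> Bij UNIV" "f \<in> Bij UNIV"
    using assms by (simp_all add: Bij_def bij_fn)
  thus ?case
    using Suc
    by (simp add: BijGroup_def compose_def o_def funpow_Suc_right del: funpow.simps)
qed

theorem proposition2p3:
  fixes q t n :: nat
  assumes "primepow q" and "odd q" and "t \<ge> 3" and "n = 2 * t"
    and "card (UNIV :: 'a::{field, finite} set) = q ^ n"
  shows "(psi q t :: 'a \<Rightarrow> 'a) \<in> carrier (BijGroup UNIV) \<and>
         group.ord (BijGroup UNIV) (psi q t :: 'a \<Rightarrow> 'a) = n"
proof -
  interpret even_degree_extension q t "TYPE('a)"
  proof
    show "primepow q" "odd q"
      by (fact assms)+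
    show "t > 0"
      using assms(3) by simp
    show "card (UNIV :: 'a set) = q ^ (2 * t)"
      using assms(5) by (simp only: assms(4))
  qed
  have carrier: "(psi q t :: 'a \<Rightarrow> 'a) \<in> carrier (BijGroup UNIV)"
    using bij_psi by (simp add: BijGroup_def Bij_def)
  have one: "\<one>\<^bsub>BijGroup UNIV\<^esub> = (id :: 'a \<Rightarrow> 'a)"
    by (simp add: BijGroup_def fun_eq_iff)
  have "group.ord (BijGroup UNIV) (psi q t :: 'a \<Rightarrow> 'a) = n"
    unfolding group.ord_unique[OF group_BijGroup carrier] one pow_BijGroup_UNIV[OF bij_psi]
      funpow_psi_eq_id_iff assms(4)
    by simp
  with carrier show ?thesis ..
qed

end
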